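(* Let $\lambda$ be a nonzero real number. For all integers $m,n\ge 0$, $$\mathrm{Bel}_{n+m,\lambda}=\sum_{l=0}^{n}\sum_{k=0}^{m}(1)_{k,\lambda}{m \brace k}_{\lambda}\binom{n}{l}\mathrm{Bel}_{l,\lambda}\,F_{n-l,\lambda}^{(k)}(-\lambda,k-m\lambda).$$
   Context: For nonzero real $\lambda$, the degenerate falling factorial is $(x)_{0,\lambda}=1$, $(x)_{n,\lambda}=x(x-\lambda)\cdots(x-(n-1)\lambda)$ for $n\ge1$, and the degenerate exponential is $e_{\lambda}^{x}(t)=(1+\lambda t)^{x/\lambda}=\sum_{k\ge0}(x)_{k,\lambda}\frac{t^k}{k!}$, with $e_\lambda(t)=e_\lambda^1(t)$. The degenerate Stirling numbers of the second kind ${n \brace k}_{\lambda}$ are defined by $\frac{1}{k!}(e_{\lambda}(t)-1)^{k}=\sum_{n\ge k}{n \brace k}_{\lambda}\frac{t^{n}}{n!}$ for $k\ge0$ (equivalently $(x)_{n,\lambda}=\sum_{k=0}^n {n \brace k}_{\lambda}(x)_k$, where $(x)_k$ is the ordinary falling factorial). The fully degenerate Bell polynomials are $\mathrm{Bel}_{n,\lambda}(x)=\sum_{k=0}^{n}{n \brace k}_{\lambda}(1)_{k,\lambda}x^{k}$, equivalently $e_{\lambda}\big(x(e_{\lambda}(t)-1)\big)=\sum_{n\ge0}\mathrm{Bel}_{n,\lambda}(x)\frac{t^n}{n!}$; the fully degenerate Bell numbers are $\mathrm{Bel}_{n,\lambda}=\mathrm{Bel}_{n,\lambda}(1)$. The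 two-variable degenerate Fubini polynomials of order $\alpha$ are defined by $\Big(\frac{1}{1-x(e_{\lambda}(t)-1)}\Big)^{\alpha}e_{\lambda}^{y}(t)=\sum_{n\ge0}F_{n,\lambda}^{(\alpha)}(x,y)\frac{t^{n}}{n!}$. *)

theory Defs
  imports "HOL-Computational_Algebra.Computational_Algebra"
begin

definition degen_ffact :: "real \<Rightarrow> real \<Rightarrow> nat \<Rightarrow> real" where
  "degen_ffact lam x n = (\<Prod>i<n. x - real i * lam)"

text \<open>Generating functions are formal power series in \<open>t\<close>; the series of
  \<open>(1 + lam t) powr (x / lam)\<close> is given by its coefficients.\<close>

definition degen_exp :: "real \<Rightarrow> real \<Rightarrow> real fps" where
  "degen_exp lam x = Abs_fps (\<lambda>k. degen_ffact lam x k / fact k)"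

lemma degen_exp_eq_binomial:
  assumes "lam \<noteq> 0"
  shows "degen_exp lam x = fps_binomial (x / lam) oo (fps_const lam * fps_X)"
proof (rule fps_ext)
  fix n
  have "degen_ffact lam x n = lam ^ n * (\<Prod>i<n. x / lam - real i)"
  proof -
    have "(\<Prod>i<n. x - real i * lam) = (\<Prod>i<n. lam * (x / lam - real i))"
      using assms by (intro prod.cong) (auto simp: field_simps)
    then show ?thesis
      by (simp add: degen_ffact_def prod.distrib)
  qed
  then show "degen_exp lam x $ n = (fps_binomial (x / lam) oo (fps_const lam * fps_X)) $ n"
    by (simp add: degen_exp_def fps_compose_linear gbinomial_prod_rev atLeast0LessThan)
qed

definition degen_Stirling2 :: "real \<Rightarrow> nat \<Rightarrow> nat \<Rightarrow> real" where
  "degen_Stirling2 lam n k =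
     fact n * fps_nth (fps_const (1 / fact k) * (degen_exp lam 1 - 1) ^ k) n"

definition degen_Bell_poly :: "real \<Rightarrow> nat \<Rightarrow> real \<Rightarrow> real" where
  "degen_Bell_poly lam n x =
     (\<Sum>k=0..n. degen_Stirling2 lam n k * degen_ffact lam 1 k * x ^ k)"

definition degen_Bell :: "real \<Rightarrow> nat \<Rightarrow> real" where
  "degen_Bell lam n = degen_Bell_poly lam n 1"

text \<open>The order \<open>\<alpha>\<close> is a natural number. The divisor has constant term 1, so it is a
  unit of the ring of power series.\<close>

definition degen_Fubini :: "real \<Rightarrow> nat \<Rightarrow> nat \<Rightarrow> real \<Rightarrow> real \<Rightarrow> real" where
  "degen_Fubini lam \<alpha> n x y =
     fact n * fps_nth ((1 / (1 - fps_const x * (degen_exp lam 1 - 1))) ^ \<alpha> * degen_exp lam y) n"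

end

theory Submission imports Defs begin

text \<open>
  Write \<open>e(x) = degen_exp lam x\<close> and \<open>B(x) = e(x) oo (e(1) - 1)\<close>, so that \<open>B(1)\<close> is the exponential
  generating function of the Bell numbers. Since \<open>D e(x) = x e(x - lam)\<close>, induction on \<open>m\<close> with the
  triangular recurrence of the degenerate Stirling numbers gives
  \<open>D\<^sup>m B(1) = (\<Sum>k\<le>m. S(m,k) (1)\<^sub>k B(1 - k lam) e(k - m lam))\<close>.
  As \<open>B(x + y) = B(x) B(y)\<close> and \<open>B(lam) = 1 + lam (e(1) - 1)\<close>, each term is \<open>B(1)\<close> times a
  Fubini generating function; compare the coefficients of \<open>t\<^sup>n / n!\<close>.
\<close>

text \<open>Each derivative moves an exponential generating function by one index; this is how the
  index \<open>n + m\<close> is reached.\<close>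

lemma fact_mult_fps_nth_deriv_nth:
  fixes f :: "'a::{comm_semiring_1,semiring_char_0} fps"
  shows "fact n * fps_nth_deriv m f $ n = fact (n + m) * f $ (n + m)"
  by (induction m arbitrary: f) (simp_all add: mult_ac)

lemma degen_ffact_0 [simp]: "degen_ffact lam x 0 = 1"
  by (simp add: degen_ffact_def)

lemma degen_ffact_Suc: "degen_ffact lam x (Suc n) = degen_ffact lam x n * (x - real n * lam)"
  by (simp add: degen_ffact_def)

lemma degen_ffact_Suc_shift: "degen_ffact lam x (Suc n) = x * degen_ffact lam (x - lam) n"
  unfolding degen_ffact_def prod.lessThan_Suc_shift by (simp add: algebra_simps)

lemma degen_exp_nth_0 [simp]: "degen_exp lam x $ 0 = 1"
  by (simp add: degen_exp_def degen_ffact_def)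

lemma degen_exp_0 [simp]: "degen_exp lam 0 = 1"
proof (rule fps_ext)
  show "degen_exp lam 0 $ n = 1 $ n" for n
    by (cases n) (simp_all add: degen_exp_def degen_ffact_Suc_shift)
qed

lemma degen_exp_step: "degen_exp lam lam = 1 + fps_const lam * fps_X"
proof (rule fps_ext)
  fix n
  show "degen_exp lam lam $ n = (1 + fps_const lam * fps_X) $ n"
  proof (cases n)
    case (Suc k)
    then show ?thesis
      by (cases k) (simp_all add: degen_exp_def degen_ffact_Suc_shift)
  qed simp
qed

lemma fps_deriv_degen_exp:
  "fps_deriv (degen_exp lam x) = fps_const x * degen_exp lam (x - lam)"
proof (rule fps_ext)
  show "fps_deriv (degen_exp lam x) $ n = (fps_const x * degen_exp lam (x - lam)) $ n" for n
    by (simp add: degen_exp_def degen_ffact_Suc_shift field_simps del: of_nat_Suc)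
qed

text \<open>For \<open>lam\<close> nonzero the series is the binomial series with exponent
  \<open>x / lam\<close>, evaluated at \<open>lam * t\<close>, so exponents add.\<close>

lemma degen_exp_add:
  assumes "lam \<noteq> 0"
  shows "degen_exp lam (x + y) = degen_exp lam x * degen_exp lam y"
  using assms
  by (simp add: degen_exp_eq_binomial add_divide_distrib fps_binomial_add_mult
      fps_compose_mult_distrib)

text \<open>The series \<open>degen_exp lam 1 - 1\<close> has no constant term, so its
  \<open>k\<close>-th power starts at \<open>t^k\<close>.\<close>

lemma degen_Stirling2_eq_0: "n < k \<Longrightarrow> degen_Stirling2 lam n k = 0"
  using startsby_zero_power_prefix[of "degen_exp lam 1 - 1" k]
  by (simp add: degen_Stirling2_def)

text \<open>Coefficient form of \<open>(1 + lam t) D W(k + 1) = (k + 1) W(k + 1) + W(k)\<close>, where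
  \<open>W(k) = (e(1) - 1)\<^sup>k / k!\<close>.\<close>

lemma degen_Stirling2_Suc_Suc:
  assumes "lam \<noteq> 0"
  shows "degen_Stirling2 lam (Suc n) (Suc k) =
    degen_Stirling2 lam n k + (real (Suc k) - real n * lam) * degen_Stirling2 lam n (Suc k)"
proof -
  define E where "E = degen_exp lam 1"
  define W where "W = (\<lambda>k. fps_const (1 / fact k) * (E - 1) ^ k)"
  have S: "degen_Stirling2 lam i j = fact i * W j $ i" for i j
    by (simp add: degen_Stirling2_def W_def E_def)
  \<comment> \<open>The factor is \<open>degen_exp lam lam\<close> and the derivative is
    \<open>degen_exp lam (1 - lam)\<close>, so the exponents add up to 1.\<close>
  have step: "(1 + fps_const lam * fps_X) * fps_deriv E = E"
    using degen_exp_add[OF assms, of lam "1 - lam"]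
    by (simp only: E_def fps_deriv_degen_exp flip: degen_exp_step) simp
  have W_Suc: "fps_const (real (Suc k)) * W (Suc k) = W k * (E - 1)"
  proof -
    have "fps_const (real (Suc k)) * W (Suc k) =
        fps_const (real (Suc k) * (1 / fact (Suc k))) * (E - 1) ^ Suc k"
      unfolding W_def by (simp only: mult.assoc flip: fps_const_mult)
    also have "real (Suc k) * (1 / fact (Suc k)) = 1 / fact k"
      by (simp add: field_simps del: of_nat_Suc)
    finally show ?thesis
      by (simp add: W_def mult_ac)
  qed
  have "fps_deriv (W (Suc k)) = fps_const (1 / fact (Suc k)) * (fps_const (real (Suc k)) * fps_deriv E * (E - 1) ^ k)"
    by (simp add: W_def fps_deriv_power del: power_Suc of_nat_Suc)
  also have "\<dots> = fps_const (1 / fact (Suc k) * real (Suc k)) * (fps_deriv E * (E - 1) ^ k)"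
    by (simp only: mult.assoc flip: fps_const_mult)
  also have "1 / fact (Suc k) * real (Suc k) = 1 / fact k"
    by (simp add: field_simps del: of_nat_Suc)
  finally have W_deriv: "fps_deriv (W (Suc k)) = W k * fps_deriv E"
    by (simp add: W_def mult_ac)
  have "(1 + fps_const lam * fps_X) * fps_deriv (W (Suc k)) = W k * E"
    using step by (simp add: W_deriv mult.left_commute)
  \<comment> \<open>Write \<open>E\<close> as \<open>1 + (E - 1)\<close> and absorb the second part
    by \<open>W_Suc\<close>.\<close>
  also have "\<dots> = W k + fps_const (real (Suc k)) * W (Suc k)"
    by (simp only: W_Suc) (simp add: algebra_simps)
  finally have "((1 + fps_const lam * fps_X) * fps_deriv (W (Suc k))) $ n =
      W k $ n + real (Suc k) * W (Suc k) $ n"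
    by (simp del: of_nat_Suc)
  moreover have "((1 + fps_const lam * fps_X) * fps_deriv (W (Suc k))) $ n =
      real (Suc n) * W (Suc k) $ Suc n + lam * (real n * W (Suc k) $ n)"
    by (cases n) (simp_all add: distrib_right mult.assoc del: of_nat_Suc)
  ultimately have "real (Suc n) * W (Suc k) $ Suc n =
      W k $ n + (real (Suc k) - real n * lam) * W (Suc k) $ n"
    by (simp add: algebra_simps del: of_nat_Suc)
  then have "fact n * (real (Suc n) * W (Suc k) $ Suc n) =
      fact n * (W k $ n + (real (Suc k) - real n * lam) * W (Suc k) $ n)"
    by simp
  then show ?thesis
    by (simp add: S algebra_simps del: of_nat_Suc)
qed

text \<open>Both sides vanish: the factor \<open>n\<close> handles \<open>n = 0\<close>, and the
  Stirling number is 0 otherwise. The form is the triangular recurrence at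
  \<open>k = 0\<close>.\<close>

lemma degen_Stirling2_Suc_0:
  "degen_Stirling2 lam (Suc n) 0 = - (real n * lam) * degen_Stirling2 lam n 0"
  by (cases n) (simp_all add: degen_Stirling2_def)

text \<open>Formally \<open>(1 + lam * (e - 1))\<close> to the power \<open>x / lam\<close>, with
  \<open>e = degen_exp lam 1\<close> and \<open>lam\<close> nonzero. Here \<open>x\<close> is an
  exponent, not the argument of the Bell polynomial.\<close>

definition degen_exp_compose :: "real \<Rightarrow> real \<Rightarrow> real fps" where
  "degen_exp_compose lam x = degen_exp lam x oo (degen_exp lam 1 - 1)"

lemma degen_Bell_eq_nth: "degen_Bell lam n = fact n * degen_exp_compose lam 1 $ n"
  unfolding degen_Bell_def degen_Bell_poly_def degen_exp_compose_def fps_compose_nth sum_distrib_left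
  by (intro sum.cong) (simp_all add: degen_Stirling2_def degen_exp_def)

lemma degen_exp_compose_add:
  assumes "lam \<noteq> 0"
  shows "degen_exp_compose lam (x + y) = degen_exp_compose lam x * degen_exp_compose lam y"
  using assms by (simp add: degen_exp_compose_def degen_exp_add fps_compose_mult_distrib)

text \<open>The exponent \<open>lam\<close> gives an affine series and exponents add, so
  \<open>- lam\<close> gives its inverse. This is the source of the Fubini argument
  \<open>- lam\<close>.\<close>

lemma degen_exp_compose_minus_step:
  assumes "lam \<noteq> 0"
  shows "degen_exp_compose lam (- lam) = 1 / (1 - fps_const (- lam) * (degen_exp lam 1 - 1))"
proof -
  have "degen_exp_compose lam lam * degen_exp_compose lam (- lam) = 1"
    using degen_exp_compose_add[OF assms, of lam "- lam"] by (simp add: degen_exp_compose_def)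
  moreover have "degen_exp_compose lam lam = 1 + fps_const lam * (degen_exp lam 1 - 1)"
    by (simp add: degen_exp_compose_def degen_exp_step fps_compose_add_distrib
        fps_compose_mult_distrib)
  ultimately have "inverse (1 + fps_const lam * (degen_exp lam 1 - 1)) = degen_exp_compose lam (- lam)"
    by (intro fps_inverse_unique) simp
  then show ?thesis
    by (simp add: fps_divide_unit flip: fps_const_neg)
qed

lemma degen_exp_compose_minus_steps:
  assumes "lam \<noteq> 0"
  shows "degen_exp_compose lam (x - real k * lam) =
    degen_exp_compose lam x * (1 / (1 - fps_const (- lam) * (degen_exp lam 1 - 1))) ^ k"
proof (induction k)
  case (Suc k)
  have "x - real (Suc k) * lam = (x - real k * lam) + (- lam)"
    by (simp add: algebra_simps)
  then have "degen_exp_compose lam (x - real (Suc k) * lam) =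
      degen_exp_compose lam (x - real k * lam) * degen_exp_compose lam (- lam)"
    by (simp only: degen_exp_compose_add[OF assms])
  then show ?case
    unfolding Suc.IH degen_exp_compose_minus_step[OF assms] by (simp only: power_Suc mult_ac)
qed simp

lemma fps_deriv_degen_exp_compose:
  "fps_deriv (degen_exp_compose lam x) =
    fps_const x * degen_exp_compose lam (x - lam) * degen_exp lam (1 - lam)"
  by (simp add: degen_exp_compose_def fps_compose_deriv fps_deriv_degen_exp
      fps_compose_mult_distrib)

lemma nth_deriv_degen_exp_compose:
  assumes "lam \<noteq> 0"
  shows "fps_nth_deriv m (degen_exp_compose lam x) =
    (\<Sum>k\<le>m. fps_const (degen_Stirling2 lam m k) * (fps_const (degen_ffact lam x k) *
      degen_exp_compose lam (x - real k * lam) * degen_exp lam (real k - real m * lam)))"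
proof (induction m)
  case 0
  show ?case by (simp add: degen_Stirling2_def degen_ffact_def)
next
  case (Suc m)
  define S where "S = degen_Stirling2 lam"
  define V where "V = (\<lambda>m k. fps_const (degen_ffact lam x k) *
      degen_exp_compose lam (x - real k * lam) * degen_exp lam (real k - real m * lam))"
  \<comment> \<open>Product rule: differentiating the composed factor raises \<open>k\<close>, while
    differentiating the last factor keeps \<open>k\<close> and brings down its exponent.\<close>
  have V_deriv: "fps_deriv (V m k) =
      V (Suc m) (Suc k) + fps_const (real k - real m * lam) * V (Suc m) k" for k
  proof -
    have a: "real (Suc k) - real (Suc m) * lam = (1 - lam) + (real k - real m * lam)"
      and b: "real k - real (Suc m) * lam = real k - real m * lam - lam"
      and c: "x - real (Suc k) * lam = x - real k * lam - lam"
      by (simp_all add: algebra_simps)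
    show ?thesis
      unfolding V_def a b c degen_exp_add[OF assms, of "1 - lam"] degen_ffact_Suc
      by (simp add: fps_deriv_degen_exp fps_deriv_degen_exp_compose distrib_left mult_ac add_ac flip: fps_const_mult)
  qed
  have "fps_nth_deriv (Suc m) (degen_exp_compose lam x) = fps_deriv (\<Sum>k\<le>m. fps_const (S m k) * V m k)"
    by (simp only: fps_nth_deriv_commute Suc.IH V_def S_def)
  also have "\<dots> = (\<Sum>k\<le>m. fps_const (S m k) * V (Suc m) (Suc k)) +
      (\<Sum>k\<le>m. fps_const ((real k - real m * lam) * S m k) * V (Suc m) k)"
    by (simp add: fps_deriv_sum V_deriv sum.distrib distrib_left mult_ac flip: fps_const_mult)
  \<comment> \<open>The added term at \<open>Suc m\<close> is zero. Splitting off
    \<open>k = 0\<close> then aligns both sums on \<open>V (Suc m) (Suc k)\<close>, ready for the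
    triangular recurrence.\<close>
  also have "(\<Sum>k\<le>m. fps_const ((real k - real m * lam) * S m k) * V (Suc m) k) =
      (\<Sum>k\<le>Suc m. fps_const ((real k - real m * lam) * S m k) * V (Suc m) k)"
    by (simp add: S_def degen_Stirling2_eq_0)
  also have "\<dots> = fps_const (S (Suc m) 0) * V (Suc m) 0 +
      (\<Sum>k\<le>m. fps_const ((real (Suc k) - real m * lam) * S m (Suc k)) * V (Suc m) (Suc k))"
    unfolding sum.atMost_Suc_shift by (simp add: S_def degen_Stirling2_Suc_0)
  also have "(\<Sum>k\<le>m. fps_const (S m k) * V (Suc m) (Suc k)) + \<dots> =
      fps_const (S (Suc m) 0) * V (Suc m) 0 + (\<Sum>k\<le>m. fps_const (S (Suc m) (Suc k)) * V (Suc m) (Suc k))"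
    by (simp add: S_def degen_Stirling2_Suc_Suc[OF assms] distrib_right sum.distrib
        del: of_nat_Suc flip: fps_const_add)
  also have "\<dots> = (\<Sum>k\<le>Suc m. fps_const (S (Suc m) k) * V (Suc m) k)"
    unfolding sum.atMost_Suc_shift ..
  finally show ?case
    by (simp only: S_def V_def)
qed

theorem theorem1:
  fixes lam :: real and m n :: nat
  assumes "lam \<noteq> 0"
  shows "degen_Bell lam (n + m) =
    (\<Sum>l=0..n. \<Sum>k=0..m. degen_ffact lam 1 k * degen_Stirling2 lam m k * real (n choose l)
       * degen_Bell lam l * degen_Fubini lam k (n - l) (-lam) (real k - real m * lam))"
proof -
  define B where "B = degen_exp_compose lam 1"
  define F where "F = (\<lambda>k. (1 / (1 - fps_const (- lam) * (degen_exp lam 1 - 1))) ^ k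
    * degen_exp lam (real k - real m * lam))"
  have "fps_nth_deriv m B = (\<Sum>k\<le>m. fps_const (degen_ffact lam 1 k * degen_Stirling2 lam m k) * (B * F k))"
    unfolding B_def nth_deriv_degen_exp_compose[OF assms] degen_exp_compose_minus_steps[OF assms] F_def
    by (intro sum.cong refl) (simp only: mult_ac flip: fps_const_mult)
  then have "fps_nth_deriv m B $ n =
      (\<Sum>k\<le>m. degen_ffact lam 1 k * degen_Stirling2 lam m k * (\<Sum>l=0..n. B $ l * F k $ (n - l)))"
    by (simp add: fps_sum_nth) (simp add: fps_mult_nth)
  moreover have "degen_Bell lam (n + m) = fact n * fps_nth_deriv m B $ n"
    by (simp add: degen_Bell_eq_nth B_def fact_mult_fps_nth_deriv_nth)
  ultimately have "degen_Bell lam (n + m) =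
      (\<Sum>k\<le>m. \<Sum>l=0..n. fact n * (degen_ffact lam 1 k * degen_Stirling2 lam m k * (B $ l * F k $ (n - l))))"
    by (simp add: sum_distrib_left)
  \<comment> \<open>Split \<open>fact n\<close> as
    \<open>(n choose l) * fact l * fact (n - l)\<close>; the last two factors turn coefficients into
    Bell and Fubini numbers.\<close>
  also have "\<dots> = (\<Sum>k\<le>m. \<Sum>l=0..n. degen_ffact lam 1 k * degen_Stirling2 lam m k * real (n choose l)
       * degen_Bell lam l * degen_Fubini lam k (n - l) (-lam) (real k - real m * lam))"
    by (intro sum.cong refl)
      (simp add: degen_Bell_eq_nth degen_Fubini_def B_def F_def binomial_fact)
  finally show ?thesis
    unfolding atMost_atLeast0 by (subst sum.swap)
qed

end
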